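(* For all $t\ne0$ and $k\in\mathbb{N}$, $$\frac1{(1-e^{-t})^k}=\sum_{i=1}^{k}a_{k,i-1}\biggl(\frac1{1-e^{-t}}\biggr)^{(i-1)},$$ where $a_{k,i-1}=(-1)^{i^2+1}|M_{k-i+1}(k,i)|$ for $1\le i\le k$.
   Context: $\mathbb{N}$ is the set of positive integers and $t$ is a real variable. For a function $f$ of $t$, $f^{(n)}$ denotes the $n$-th derivative with respect to $t$, with $f^{(0)}=f$. For $1\le m\le n$, $S(n,m)=\frac1{m!}\sum_{\ell=0}^m(-1)^{m-\ell}\binom{m}{\ell}\ell^{n}$ are the Stirling numbers of the second kind. For $1\le i\le k$ and $1\le j\le k-i+1$, $|M_j(k,i)|$ is the determinant of the $j\times j$ matrix whose $(r,1)$ entry is $\frac{1}{(i+r-2)!}\binom{k}{i+r-1}$ for $1\le r\le j$, and whose $(r,c)$ entry for $2\le c\le j$ is $S(i+c-1,i+r-1)$ if $r\le c$ and $0$ if $r>c$; in particular $|M_1(k,i)|=\frac1{(i-1)!}\binom{k}{i}$. *)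

theory Defs
  imports
    "HOL-Analysis.Derivative"
    "HOL-Combinatorics.Stirling"
    "Jordan_Normal_Form.Determinant"
begin

text \<open>\<^const>\<open>Stirling\<close> is defined by its recurrence; the following identities
  show that it satisfies the usual explicit formula for the Stirling numbers of the second kind.\<close>

lemma sum_alternating_binomial_power_Suc:
  fixes n m :: nat
  defines "T \<equiv> \<lambda>n m. \<Sum>l\<le>m. (-1) ^ (m - l) * real (m choose l) * real l ^ n"
  shows "T (Suc n) (Suc m) = real (Suc m) * (T n (Suc m) + T n m)"
proof -
  define U where "U = (\<Sum>l\<le>m. (-1) ^ (m - l) * real (m choose l) * real (Suc l) ^ n)"
  have "T (Suc n) (Suc m) = (\<Sum>l\<le>m. (-1) ^ (m - l) * real (Suc m choose Suc l) * real (Suc l) ^ Suc n)"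
    unfolding T_def by (subst sum.atMost_Suc_shift) simp
  also have "\<dots> = (\<Sum>l\<le>m. real (Suc m) * ((-1) ^ (m - l) * real (m choose l) * real (Suc l) ^ n))"
  proof (rule sum.cong[OF refl])
    fix l
    have "real (Suc l) * real (Suc m choose Suc l) = real (Suc m) * real (m choose l)"
      unfolding of_nat_mult[symmetric] by (simp only: Suc_times_binomial_eq mult.commute)
    then have "(-1) ^ (m - l) * real (Suc l) ^ n * (real (Suc l) * real (Suc m choose Suc l))
        = (-1) ^ (m - l) * real (Suc l) ^ n * (real (Suc m) * real (m choose l))"
      by (simp only:)
    then show "(-1) ^ (m - l) * real (Suc m choose Suc l) * real (Suc l) ^ Suc n
        = real (Suc m) * ((-1) ^ (m - l) * real (m choose l) * real (Suc l) ^ n)"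
      by (simp only: power_Suc mult_ac)
  qed
  finally have 1: "T (Suc n) (Suc m) = real (Suc m) * U"
    by (simp only: U_def sum_distrib_left)
  have "T n (Suc m) = (-1) ^ Suc m * real 0 ^ n
      + (\<Sum>l\<le>m. (-1) ^ (m - l) * real (Suc m choose Suc l) * real (Suc l) ^ n)"
    unfolding T_def by (subst sum.atMost_Suc_shift) simp
  also have "(\<Sum>l\<le>m. (-1) ^ (m - l) * real (Suc m choose Suc l) * real (Suc l) ^ n)
      = U + (\<Sum>l\<le>m. (-1) ^ (m - l) * real (m choose Suc l) * real (Suc l) ^ n)"
    unfolding U_def sum.distrib[symmetric] by (rule sum.cong) (auto simp: algebra_simps)
  also have "(-1) ^ Suc m * real 0 ^ n + (U + (\<Sum>l\<le>m. (-1) ^ (m - l) * real (m choose Suc l) * real (Suc l) ^ n))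
      = U + (\<Sum>l\<le>Suc m. (-1) ^ (Suc m - l) * real (m choose l) * real l ^ n)"
    by (simp only: sum.atMost_Suc_shift) simp
  also have "(\<Sum>l\<le>Suc m. (-1) ^ (Suc m - l) * real (m choose l) * real l ^ n) = - T n m"
    unfolding T_def by (simp add: Suc_diff_le sum_negf)
  finally have "U = T n (Suc m) + T n m" by simp
  with 1 show ?thesis by simp
qed

lemma fact_times_Stirling:
  "fact m * real (Stirling n m) = (\<Sum>l\<le>m. (-1) ^ (m - l) * real (m choose l) * real l ^ n)"
proof (induction n m rule: Stirling.induct)
  case (2 k)
  have "(\<Sum>l\<le>Suc k. real (Suc k choose l) * 1 ^ l * (-1) ^ (Suc k - l)) = (1 + (-1::real)) ^ Suc k"
    by (rule binomial_ring[symmetric])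
  then show ?case by (simp add: mult.commute)
next
  case (4 n k)
  show ?case
    unfolding sum_alternating_binomial_power_Suc 4[symmetric] by (simp add: algebra_simps)
qed auto

lemma Stirling_explicit:
  "real (Stirling n m) = 1 / fact m * (\<Sum>l=0..m. (-1) ^ (m - l) * real (m choose l) * real l ^ n)"
  by (simp add: fact_times_Stirling[symmetric] atLeast0AtMost)

text \<open>Rows and columns of \<open>M_entry\<close> are counted from 1, those of \<^const>\<open>mat\<close> from 0.\<close>

definition M_entry :: "nat \<Rightarrow> nat \<Rightarrow> nat \<Rightarrow> nat \<Rightarrow> real" where
  "M_entry k i r c =
     (if c = 1 then 1 / fact (i + r - 2) * real (k choose (i + r - 1))
      else if r \<le> c then real (Stirling (i + c - 1) (i + r - 1))
      else 0)"

definition M :: "nat \<Rightarrow> nat \<Rightarrow> nat \<Rightarrow> real mat" where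
  "M j k i = mat j j (\<lambda>(r, c). M_entry k i (r + 1) (c + 1))"

text \<open>\<open>a_coeff k (i - 1)\<close> is the coefficient $a_{k,i-1}$; the definition is written in terms of
  the second index \<open>p = i - 1\<close>.\<close>

definition a_coeff :: "nat \<Rightarrow> nat \<Rightarrow> real" where
  "a_coeff k p = (let i = p + 1 in (-1) ^ (i\<^sup>2 + 1) * Determinant.det (M (k - i + 1) k i))"

end

theory Submission
  imports Defs
begin

text \<open>
  The function \<open>y = 1 / (1 - exp (- t))\<close> satisfies \<open>y' = y - y\<^sup>2\<close>, so that
  \<open>k * y ^ (k + 1) = k * y ^ k - (y ^ k)'\<close>. Iterating this formula expresses a power of
  \<open>y\<close> as a combination of derivatives, whose coefficients obey the recurrence of the Stirling
  numbers of the first kind: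
  \<open>(k - 1)! * y ^ k\<close> is the sum of \<open>(-1) ^ (i - 1) * stirling k i\<close> times the
  derivative of order \<open>i - 1\<close> of \<open>y\<close>, over \<open>1 \<le> i \<le> k\<close>
  (lemma \<open>fact_times_power_geom_exp\<close>).

  The determinant has to be recognised as \<open>stirling k i / (k - 1)!\<close>
  (lemma \<open>det_M_eq_stirling\<close>). Except for its first column, the matrix is the block with
  indices from \<open>i\<close> to \<open>k\<close> of the unitriangular matrix of Stirling numbers of the second
  kind. By Cramer's rule the determinant is therefore the first unknown of the linear system
  with this triangular matrix and with the first column as right-hand side. That the numbers
  \<open>stirling k n / (k - 1)!\<close>, \<open>i \<le> n \<le> k\<close>, solve the system is the classical fact that the
  product of the two triangles of unsigned Stirling numbers is the triangle of Lah numbers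
  (lemma \<open>fact_times_sum_stirling_Stirling\<close>).
\<close>

section \<open>The product of the two Stirling triangles\<close>

lemma Suc_times_binomial_Suc_add:
  "Suc j * (n choose Suc j) + j * (n choose j) = n * (n choose j)"
proof (cases "j \<le> n")
  case True
  have "Suc j * (n choose Suc j) = (n - j) * (n choose j)"
    by (simp only: binomial_absorption binomial_absorb_comp)
  with True show ?thesis
    by (simp only: add_mult_distrib[symmetric] le_add_diff_inverse2)
qed (simp add: binomial_eq_0)

text \<open>The recurrence of the Lah numbers: the recurrences of the two Stirling triangles
  contribute \<open>k\<close> and \<open>m + 1\<close> to the factor.\<close>

lemma sum_stirling_Stirling_rec:
  "(\<Sum>n\<le>Suc k. stirling (Suc k) n * Stirling n (Suc m)) =
     (k + Suc m) * (\<Sum>n\<le>k. stirling k n * Stirling n (Suc m)) + (\<Sum>n\<le>k. stirling k n * Stirling n m)"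
proof -
  have "(\<Sum>n\<le>Suc k. stirling (Suc k) n * Stirling n (Suc m)) =
      (\<Sum>n\<le>k. stirling (Suc k) (Suc n) * Stirling (Suc n) (Suc m))"
    by (subst sum.atMost_Suc_shift) simp
  also have "\<dots> = (\<Sum>n\<le>k. k * (stirling k (Suc n) * Stirling (Suc n) (Suc m))) +
      (\<Sum>n\<le>k. stirling k n * Stirling (Suc n) (Suc m))"
    unfolding sum.distrib[symmetric] by (rule sum.cong) (simp_all add: algebra_simps)
  also have "(\<Sum>n\<le>k. k * (stirling k (Suc n) * Stirling (Suc n) (Suc m))) =
      k * (\<Sum>n\<le>Suc k. stirling k n * Stirling n (Suc m))"
    by (subst sum.atMost_Suc_shift) (simp add: sum_distrib_left)
  also have "(\<Sum>n\<le>Suc k. stirling k n * Stirling n (Suc m)) = (\<Sum>n\<le>k. stirling k n * Stirling n (Suc m))"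
    by simp
  also have "(\<Sum>n\<le>k. stirling k n * Stirling (Suc n) (Suc m)) =
      Suc m * (\<Sum>n\<le>k. stirling k n * Stirling n (Suc m)) + (\<Sum>n\<le>k. stirling k n * Stirling n m)"
    unfolding sum_distrib_left sum.distrib[symmetric]
    by (rule sum.cong) (simp_all add: algebra_simps)
  finally show ?thesis by (simp add: algebra_simps)
qed

text \<open>The sum is the Lah number \<open>(k + 1)! / (m + 1)! * (k choose m)\<close>: it counts the partitions
  of \<open>k + 1\<close> elements into \<open>m + 1\<close> linearly ordered blocks, which arise by grouping the cycles
  of a permutation. The form below is the one with integer factors that matches the first
  column of the matrix.\<close>

lemma fact_times_sum_stirling_Stirling:
  "fact m * (\<Sum>n\<le>Suc k. stirling (Suc k) n * Stirling n (Suc m)) = fact k * (Suc k choose Suc m)"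
proof (induction k arbitrary: m)
  case 0
  then show ?case by (cases m) auto
next
  case (Suc k)
  define L where "L = (\<lambda>m. \<Sum>n\<le>Suc k. stirling (Suc k) n * Stirling n m)"
  have IH: "fact m * L (Suc m) = fact k * (Suc k choose Suc m)" for m
    unfolding L_def by (rule Suc.IH)
  have lower: "fact m * L m = m * (fact k * (Suc k choose m))"
  proof (cases m)
    case 0
    have "stirling (Suc k) n * Stirling n 0 = 0" for n by (cases n) auto
    then show ?thesis unfolding L_def 0 by simp
  next
    case (Suc p)
    then show ?thesis using IH[of p] by (simp only: fact_Suc of_nat_id mult.assoc)
  qed
  have "(\<Sum>n\<le>Suc (Suc k). stirling (Suc (Suc k)) n * Stirling n (Suc m)) =
      (Suc k + Suc m) * L (Suc m) + L m"
    unfolding L_def by (rule sum_stirling_Stirling_rec)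
  then have "fact m * (\<Sum>n\<le>Suc (Suc k). stirling (Suc (Suc k)) n * Stirling n (Suc m)) =
      (Suc k + Suc m) * (fact m * L (Suc m)) + fact m * L m"
    by (simp only: algebra_simps)
  also have "\<dots> = fact k * (Suc k * (Suc k choose Suc m) +
      (Suc m * (Suc k choose Suc m) + m * (Suc k choose m)))"
    unfolding IH lower by (simp only: algebra_simps)
  also have "\<dots> = fact (Suc k) * (Suc (Suc k) choose Suc m)"
    unfolding Suc_times_binomial_Suc_add binomial_Suc_Suc[of "Suc k"] fact_Suc of_nat_id
    by (simp only: algebra_simps)
  finally show ?case .
qed

lemma sum_stirling_Stirling:
  assumes "1 \<le> k" "1 \<le> m"
  shows "(\<Sum>n\<le>k. real (Stirling n m) * (real (stirling k n) / fact (k - 1))) =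
    1 / fact (m - 1) * real (k choose m)"
proof -
  obtain k' m' where [simp]: "k = Suc k'" "m = Suc m'"
    using assms by (metis One_nat_def Suc_le_D)
  define L where "L = (\<Sum>n\<le>k. stirling k n * Stirling n m)"
  have "(\<Sum>n\<le>k. real (Stirling n m) * (real (stirling k n) / fact k')) = real L / fact k'"
    by (simp add: L_def sum_divide_distrib mult.commute del: sum.atMost_Suc)
  moreover have "fact m' * L = fact k' * (k choose m)"
    using fact_times_sum_stirling_Stirling[of m' k'] by (simp only: L_def \<open>k = _\<close> \<open>m = _\<close>)
  then have "fact m' * real L = fact k' * real (k choose m)"
    by (metis of_nat_fact of_nat_mult)
  ultimately show ?thesis
    by (simp add: field_simps del: binomial_Suc_Suc)
qed

section \<open>Evaluation of the determinant\<close>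

text \<open>Let \<open>U\<close> be the matrix of the numbers \<open>Stirling n m\<close>, with rows \<open>m\<close> and columns \<open>n\<close>
  from \<open>i\<close> to \<open>k\<close>, and let \<open>x\<close> be the vector of the numbers \<open>stirling k n / (k - 1)!\<close>. The
  matrix is \<open>U\<close> with its first column replaced by \<open>U x\<close>, so that Cramer's rule gives the
  first entry of \<open>x\<close>. The cut-off at \<open>i\<close> is harmless since \<open>U\<close> is upper triangular: its rows
  have no nonzero entries with \<open>n < i\<close> to lose.\<close>

lemma det_M_eq_stirling:
  assumes "1 \<le> i" "i \<le> k"
  shows "Determinant.det (M (k - i + 1) k i) = real (stirling k i) / fact (k - 1)"
proof -
  define j where "j = k - i + 1"
  define U where "U = mat j j (\<lambda>(r, c). real (Stirling (i + c) (i + r)))"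
  define x where "x = vec j (\<lambda>c. real (stirling k (i + c)) / fact (k - 1))"
  have U: "U \<in> carrier_mat j j" and x: "x \<in> carrier_vec j" and j: "0 < j"
    by (auto simp: U_def x_def j_def)
  have Ux: "(U *\<^sub>v x) $ r = 1 / fact (i + r - 1) * real (k choose (i + r))" if "r < j" for r
  proof -
    let ?f = "\<lambda>n. real (Stirling n (i + r)) * (real (stirling k n) / fact (k - 1))"
    have "(U *\<^sub>v x) $ r = (\<Sum>c = 0..<j. ?f (i + c))"
      using that by (simp add: U_def x_def scalar_prod_def)
    also have "\<dots> = (\<Sum>n = i..k. ?f n)"
      by (rule sum.reindex_bij_witness[of _ "\<lambda>n. n - i" "\<lambda>c. i + c"])
        (use assms in \<open>auto simp: j_def\<close>)
    \<comment> \<open>The terms with \<open>n < i\<close> vanish since \<open>Stirling n (i + r) = 0\<close>.\<close>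
    also have "\<dots> = (\<Sum>n\<le>k. ?f n)"
      by (rule sum.mono_neutral_left) auto
    also have "\<dots> = 1 / fact (i + r - 1) * real (k choose (i + r))"
      using assms by (intro sum_stirling_Stirling) auto
    finally show ?thesis .
  qed
  have "M j k i = replace_col U (U *\<^sub>v x) 0"
  proof (rule eq_matI)
    fix r c assume "r < dim_row (replace_col U (U *\<^sub>v x) 0)" "c < dim_col (replace_col U (U *\<^sub>v x) 0)"
    then have rc: "r < j" "c < j" by (simp_all add: replace_col_def U_def)
    show "M j k i $$ (r, c) = replace_col U (U *\<^sub>v x) 0 $$ (r, c)"
    proof (cases "c = 0")
      case True
      then show ?thesis
        using rc Ux[OF rc(1)] by (simp add: M_def M_entry_def replace_col_def U_def)
    next
      case False
      then show ?thesis
        using rc by (simp add: M_def M_entry_def replace_col_def U_def)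
    qed
  qed (simp_all add: M_def replace_col_def U_def)
  then have "Determinant.det (M j k i) = x $ 0 * Determinant.det U"
    using cramer_lemma_mat[OF U x j] by simp
  also have "Determinant.det U = 1"
  proof -
    have "Determinant.det U = prod_list (diag_mat U)"
      by (rule det_upper_triangular[OF _ U]) (auto simp: U_def)
    also have "diag_mat U = replicate j 1"
      by (auto simp: diag_mat_def U_def intro!: nth_equalityI)
    finally show ?thesis by simp
  qed
  finally show ?thesis using j by (simp add: j_def x_def)
qed

lemma a_coeff_eq_stirling:
  assumes "1 \<le> i" "i \<le> k"
  shows "a_coeff k (i - 1) = (-1) ^ (i - 1) * real (stirling k i) / fact (k - 1)"
proof -
  have "(-1::real) ^ (i\<^sup>2 + 1) = (-1) ^ (i - 1)"
    using assms by (simp add: minus_one_power_iff)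
  then show ?thesis
    using assms det_M_eq_stirling[OF assms] by (simp only: a_coeff_def Let_def le_add_diff_inverse2) simp
qed

section \<open>Powers in terms of derivatives\<close>

text \<open>The value at \<open>t > 0\<close> is the sum of the geometric series in \<open>exp (- t)\<close>.\<close>

abbreviation geom_exp :: "real \<Rightarrow> real" where
  "geom_exp \<equiv> \<lambda>x. 1 / (1 - exp (- x))"

text \<open>The Riccati equation \<open>y' = y - y\<^sup>2\<close> comes from \<open>y' = - exp (- t) * y\<^sup>2\<close> and
  \<open>exp (- t) * y = y - 1\<close>.\<close>

lemma DERIV_geom_exp:
  assumes "t \<noteq> 0"
  shows "(geom_exp has_real_derivative geom_exp t - (geom_exp t)\<^sup>2) (at t)"
proof -
  define e where "e = exp (- t)"
  have e: "1 - e \<noteq> 0" using assms by (simp add: e_def)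
  have "(geom_exp has_real_derivative - (e / (1 - e)\<^sup>2)) (at t)"
    unfolding e_def using e by (auto intro!: derivative_eq_intros simp: e_def power2_eq_square)
  also have "- (e / (1 - e)\<^sup>2) = 1 / (1 - e) - (1 / (1 - e))\<^sup>2"
    using e by (simp add: divide_simps power2_eq_square)
  finally show ?thesis by (simp only: e_def)
qed

lemma DERIV_poly_geom_exp:
  assumes "\<And>t. t \<noteq> 0 \<Longrightarrow> f t = poly p (geom_exp t)" and "t \<noteq> 0"
  shows "(f has_real_derivative poly (pderiv p * [:0, 1, -1:]) (geom_exp t)) (at t)"
proof -
  have "(f has_real_derivative
      poly (pderiv p) (geom_exp t) * (geom_exp t - (geom_exp t)\<^sup>2)) (at t)"
    by (rule has_field_derivative_transform_within_open[of "\<lambda>x. poly p (geom_exp x)" _ _ "- {0}"])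
      (use assms in \<open>auto intro!: DERIV_chain2[OF poly_DERIV] DERIV_geom_exp\<close>)
  then show ?thesis
    by (simp add: power2_eq_square algebra_simps)
qed

text \<open>Being a polynomial in the function itself is inherited by the derivative, because of
  the Riccati equation. This is what makes all iterated derivatives differentiable
  away from 0, the pole.\<close>

lemma iterated_deriv_geom_exp_polynomial:
  "\<exists>p. \<forall>t. t \<noteq> 0 \<longrightarrow> (deriv ^^ n) geom_exp t = poly p (geom_exp t)"
proof (induction n)
  case 0
  show ?case by (intro exI[of _ "[:0, 1:]"]) simp
next
  case (Suc n)
  then obtain p where p: "\<And>t. t \<noteq> 0 \<Longrightarrow> (deriv ^^ n) geom_exp t = poly p (geom_exp t)" by blast
  have "(deriv ^^ Suc n) geom_exp t = poly (pderiv p * [:0, 1, -1:]) (geom_exp t)" if "t \<noteq> 0" for t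
    using DERIV_imp_deriv[OF DERIV_poly_geom_exp[OF p that]] by simp
  then show ?case by blast
qed

lemma DERIV_iterated_deriv_geom_exp:
  assumes "t \<noteq> 0"
  shows "((deriv ^^ n) geom_exp has_real_derivative (deriv ^^ Suc n) geom_exp t) (at t)"
proof -
  obtain p where p: "\<And>t. t \<noteq> 0 \<Longrightarrow> (deriv ^^ n) geom_exp t = poly p (geom_exp t)"
    using iterated_deriv_geom_exp_polynomial by blast
  show ?thesis
    using DERIV_poly_geom_exp[OF p assms] by (simp add: DERIV_imp_deriv)
qed

text \<open>By the Riccati equation \<open>(y ^ k)' = k * y ^ k - k * y ^ (k + 1)\<close>. Multiplied by
  \<open>(k - 1)!\<close>, this becomes \<open>k! * y ^ (k + 1) = (k - D) ((k - 1)! * y ^ k)\<close> with \<open>D\<close> the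
  derivation. Hence \<open>k! * y ^ (k + 1)\<close> is \<open>(1 - D) (2 - D) \<dots> (k - D) y\<close>, and the
  coefficients of this product of linear factors are the signed Stirling numbers of the
  first kind.\<close>

lemma fact_times_power_geom_exp:
  "t \<noteq> 0 \<Longrightarrow> fact k * geom_exp t ^ Suc k =
     (\<Sum>p\<le>k. (-1) ^ p * real (stirling (Suc k) (Suc p)) * (deriv ^^ p) geom_exp t)"
proof (induction k arbitrary: t)
  case 0
  then show ?case by simp
next
  case (Suc k)
  let ?s = "\<lambda>k p. real (stirling (Suc k) p)" and ?d = "\<lambda>p. (deriv ^^ p) geom_exp"
  let ?R = "\<lambda>t. \<Sum>p\<le>k. (-1) ^ p * ?s k (Suc p) * ?d p t"
  have "((\<lambda>t. fact k * geom_exp t ^ Suc k) has_real_derivative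
      fact k * (real (Suc k) * (geom_exp t ^ k * (geom_exp t - (geom_exp t)\<^sup>2)))) (at t)"
    using DERIV_cmult[OF DERIV_power[OF DERIV_geom_exp[OF Suc.prems], of "Suc k"], of "fact k"]
    by (simp add: mult_ac)
  moreover have "((\<lambda>t. fact k * geom_exp t ^ Suc k) has_real_derivative
      (\<Sum>p\<le>k. (-1) ^ p * ?s k (Suc p) * ?d (Suc p) t)) (at t)"
  proof (rule has_field_derivative_transform_within_open[of ?R _ _ "- {0}"])
    show "(?R has_real_derivative (\<Sum>p\<le>k. (-1) ^ p * ?s k (Suc p) * ?d (Suc p) t)) (at t)"
      by (intro DERIV_sum DERIV_cmult DERIV_iterated_deriv_geom_exp Suc.prems)
  qed (use Suc in auto)
  ultimately have D: "fact k * (real (Suc k) * (geom_exp t ^ k * (geom_exp t - (geom_exp t)\<^sup>2))) =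
      (\<Sum>p\<le>k. (-1) ^ p * ?s k (Suc p) * ?d (Suc p) t)"
    by (rule DERIV_unique)
  have "fact (Suc k) * geom_exp t ^ Suc (Suc k) =
      real (Suc k) * (fact k * geom_exp t ^ Suc k) - fact k * (real (Suc k) * (geom_exp t ^ k * (geom_exp t - (geom_exp t)\<^sup>2)))"
    unfolding fact_Suc power_Suc power2_eq_square by (simp only: of_nat_id algebra_simps)
  also have "\<dots> = (\<Sum>p\<le>k. (-1) ^ p * (real (Suc k) * ?s k (Suc p)) * ?d p t)
      - (\<Sum>p\<le>k. (-1) ^ p * ?s k (Suc p) * ?d (Suc p) t)"
    unfolding D Suc.IH[OF Suc.prems] sum_distrib_left by (simp only: mult_ac)
  \<comment> \<open>Both sums extend to \<open>p \<le> k + 1\<close>: the first gains a term with the factor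
    \<open>stirling (k + 1) (k + 2) = 0\<close>, and the second, shifted by one, a term with the factor
    \<open>stirling (k + 1) 0 = 0\<close>.\<close>
  also have "(\<Sum>p\<le>k. (-1) ^ p * (real (Suc k) * ?s k (Suc p)) * ?d p t) =
      (\<Sum>p\<le>Suc k. (-1) ^ p * (real (Suc k) * ?s k (Suc p)) * ?d p t)"
    by simp
  also have "(\<Sum>p\<le>k. (-1) ^ p * ?s k (Suc p) * ?d (Suc p) t) =
      - (\<Sum>p\<le>Suc k. (-1) ^ p * ?s k p * ?d p t)"
    by (subst sum.atMost_Suc_shift) (simp add: sum_negf del: stirling.simps(4) sum.atMost_Suc)
  also have "(\<Sum>p\<le>Suc k. (-1) ^ p * (real (Suc k) * ?s k (Suc p)) * ?d p t) -
        - (\<Sum>p\<le>Suc k. (-1) ^ p * ?s k p * ?d p t) =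
      (\<Sum>p\<le>Suc k. (-1) ^ p * ?s (Suc k) (Suc p) * ?d p t)"
    unfolding diff_minus_eq_add sum.distrib[symmetric] stirling.simps(4)[of "Suc k"]
      of_nat_add of_nat_mult
    by (simp only: algebra_simps)
  finally show ?case .
qed

section \<open>The expansion\<close>

theorem corollary1p1:
  fixes t :: real and k :: nat
  assumes "t \<noteq> 0" and "k \<ge> 1"
  shows "1 / (1 - exp (- t)) ^ k =
    (\<Sum>i = 1..k. a_coeff k (i - 1) * (deriv ^^ (i - 1)) (\<lambda>x. 1 / (1 - exp (- x))) t)"
proof -
  obtain k' where k: "k = Suc k'" using assms(2) by (metis One_nat_def Suc_le_D)
  have "(\<Sum>i = 1..k. a_coeff k (i - 1) * (deriv ^^ (i - 1)) geom_exp t) =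
      (\<Sum>i = 1..k. (-1) ^ (i - 1) * real (stirling k i) / fact (k - 1) * (deriv ^^ (i - 1)) geom_exp t)"
    by (rule sum.cong[OF refl]) (simp only: a_coeff_eq_stirling atLeastAtMost_iff)
  also have "\<dots> = (\<Sum>p\<le>k'. (-1) ^ p * real (stirling (Suc k') (Suc p)) * (deriv ^^ p) geom_exp t) / fact k'"
    unfolding sum_divide_distrib
    by (rule sum.reindex_bij_witness[of _ Suc "\<lambda>i. i - 1"]) (auto simp: k)
  also have "\<dots> = geom_exp t ^ k"
    unfolding fact_times_power_geom_exp[OF assms(1), symmetric] k by simp
  finally show ?thesis by (simp add: power_one_over)
qed

end
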